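(* Let $\mathbb{H}_1,\mathbb{H}_2$ be complex Hilbert spaces, and let $A\in\mathbb{B}(\mathbb{H}_1,\mathbb{H}_2)$ and $B\in\mathbb{B}(\mathbb{H}_2,\mathbb{H}_1)$. Then for any $x\in\mathbb{H}_1$ and $y\in\mathbb{H}_2$, $$|\langle Ax,y\rangle|+|\langle By,x\rangle|\le \sqrt{\omega\left(|A|+\mathrm{i}|B^*|\right)\,\omega\left(|A^*|+\mathrm{i}|B|\right)+\|A\|\,\|B\|+\omega(BA)}\;\|x\|\,\|y\|.$$
   Context: $\mathbb{B}(\mathbb{H}_1,\mathbb{H}_2)$ is the set of bounded linear operators from the complex Hilbert space $\mathbb{H}_1$ to the complex Hilbert space $\mathbb{H}_2$, and $\mathbb{B}(\mathbb{H})=\mathbb{B}(\mathbb{H},\mathbb{H})$. $\|\cdot\|$ denotes the norm induced by the inner product on vectors and the usual operator norm on operators. For a bounded operator $T$ between Hilbert spaces, $T^*$ is its adjoint and $|T|=(T^*T)^{1/2}$. For $T\in\mathbb{B}(\mathbb{H})$, the numerical radius is $\omega(T)=\sup\{|\langle Tx,x\rangle|:x\in\mathbb{H},\|x\|=1\}$. $\mathrm{i}$ is the imaginary unit. *)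

theory Defs
  imports "HOL-Analysis.Analysis"
begin

text \<open>
  A complex inner product space is presented on top of the library class of real inner product
  spaces, whose inner product is required to be the real part of the complex one. Positive
  definiteness and the relation between norm and inner product are therefore inherited from
  \<open>real_inner\<close>; see \<open>cinner_self\<close> below. The complex inner product is linear in its first and
  conjugate linear in its second argument.
\<close>

class complex_inner = real_inner +
  fixes scaleC :: "complex \<Rightarrow> 'a \<Rightarrow> 'a"  (infixr "*\<^sub>C" 75)
    and cinner :: "'a \<Rightarrow> 'a \<Rightarrow> complex"
  assumes scaleC_add_right: "c *\<^sub>C (x + y) = c *\<^sub>C x + c *\<^sub>C y"
    and scaleC_add_left: "(c + d) *\<^sub>C x = c *\<^sub>C x + d *\<^sub>C x"
    and scaleC_scaleC: "c *\<^sub>C d *\<^sub>C x = (c * d) *\<^sub>C x"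
    and scaleC_of_real: "complex_of_real r *\<^sub>C x = r *\<^sub>R x"
    and cinner_commute: "cinner x y = cnj (cinner y x)"
    and cinner_add_left: "cinner (x + y) z = cinner x z + cinner y z"
    and cinner_scaleC_left: "cinner (c *\<^sub>C x) y = c * cinner x y"
    and Re_cinner: "Re (cinner x y) = x \<bullet> y"

lemma cinner_self: "cinner x x = complex_of_real ((norm x)\<^sup>2)"
proof -
  have "Im (cinner x x) = - Im (cinner x x)"
    using arg_cong[OF cinner_commute[of x x], of Im] by simp
  then show ?thesis
    by (simp add: complex_eq_iff Re_cinner power2_norm_eq_inner)
qed

lemma cinner_self_eq_0_iff: "cinner x x = 0 \<longleftrightarrow> x = 0"
  by (simp add: cinner_self)

class complex_hilbert_space = complex_inner + complete_space

instantiation complex :: complex_hilbert_space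
begin

definition scaleC_complex :: "complex \<Rightarrow> complex \<Rightarrow> complex"
  where "scaleC_complex c x = c * x"

definition cinner_complex :: "complex \<Rightarrow> complex \<Rightarrow> complex"
  where "cinner_complex x y = x * cnj y"

instance
  by standard
    (auto simp: scaleC_complex_def cinner_complex_def algebra_simps inner_complex_def
      scaleR_conv_of_real)

end

definition bounded_clinear :: "('a::complex_inner \<Rightarrow> 'b::complex_inner) \<Rightarrow> bool"
  where "bounded_clinear T \<longleftrightarrow> bounded_linear T \<and> (\<forall>c x. T (c *\<^sub>C x) = c *\<^sub>C T x)"

text \<open>
  The descriptions \<open>cadjoint\<close> and \<open>op_sqrt\<close> determine an operator when \<open>T\<close> is bounded, respectively
  when \<open>P\<close> is positive; outside of these cases they are not meaningful.
\<close>

definition cadjoint ::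
    "('a::complex_hilbert_space \<Rightarrow> 'b::complex_hilbert_space) \<Rightarrow> 'b \<Rightarrow> 'a"
  where "cadjoint T = (THE S. \<forall>x y. cinner (T x) y = cinner x (S y))"

definition positive_op :: "('a::complex_hilbert_space \<Rightarrow> 'a) \<Rightarrow> bool"
  where "positive_op T \<longleftrightarrow> bounded_clinear T \<and> (\<forall>x. cinner (T x) x \<in> \<real>\<^sub>\<ge>\<^sub>0)"

definition op_sqrt :: "('a::complex_hilbert_space \<Rightarrow> 'a) \<Rightarrow> 'a \<Rightarrow> 'a"
  where "op_sqrt P = (THE S. positive_op S \<and> S \<circ> S = P)"

definition op_abs ::
    "('a::complex_hilbert_space \<Rightarrow> 'b::complex_hilbert_space) \<Rightarrow> 'a \<Rightarrow> 'a"
  where "op_abs T = op_sqrt (cadjoint T \<circ> T)"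

text \<open>On the zero space there are no unit vectors and the supremum below is unspecified.\<close>

definition numerical_radius :: "('a::complex_hilbert_space \<Rightarrow> 'a) \<Rightarrow> real"
  where "numerical_radius T = (SUP x\<in>{x. norm x = 1}. cmod (cinner (T x) x))"

end

(*
  Write p, q, r, t for the quadratic forms of |A|, |A*|, |B*|, |B| at x, y, x, y respectively.
  The mixed Schwarz inequality and Cauchy-Schwarz in the plane give
    |<Ax,y>|^2 + |<By,x>|^2 <= p q + r t <= |p + i r| |q + i t|,
  and Buzano's inequality bounds the cross term 2 |<Ax,y>| |<y,B*x>| by
  (|Ax| |B*x| + |<BAx,x>|) |y|^2.

  The mixed Schwarz inequality needs no polar decomposition: as A |A| = |A*| A, for x = |A| w it
  is the Cauchy-Schwarz inequality of the form of |A*| at A w and y, and a general x is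
  approximated by |A| w with (|A| + e) w = x.
*)

theory Submission
  imports Defs
begin

section \<open>Positive operators on real Hilbert spaces\<close>

text \<open>Over the reals a nonnegative quadratic form does not force symmetry, so symmetry is a
  clause of its own; \<open>positive_op_imp_psd\<close> derives it from the complex
  structure.\<close>

definition psd :: "('a::real_inner \<Rightarrow> 'a) \<Rightarrow> bool"
  where "psd P \<longleftrightarrow> bounded_linear P \<and> (\<forall>x y. P x \<bullet> y = x \<bullet> P y) \<and> (\<forall>x. 0 \<le> P x \<bullet> x)"

lemma psdD:
  assumes "psd P"
  shows "bounded_linear P" "P x \<bullet> y = x \<bullet> P y" "0 \<le> P x \<bullet> x"
  using assms by (auto simp: psd_def)

text \<open>For c > 0 the quadratic is tested at its minimum t = -b/c. With a = 0 the bound forces b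
  = 0, which is how the Riesz theorem uses it.\<close>

lemma nonneg_quadratic_discriminant:
  fixes a b c :: real
  assumes nonneg: "\<And>t. 0 \<le> a + 2 * b * t + c * t\<^sup>2"
  shows "b\<^sup>2 \<le> a * c"
proof (cases "c = 0")
  case True
  have "b = 0"
  proof (rule ccontr)
    assume "b \<noteq> 0"
    \<comment> \<open>At this t the polynomial takes the value -1.\<close>
    then show False
      using nonneg[of "- (a + 1) / (2 * b)"] True by (simp add: field_simps)
  qed
  then show ?thesis using True by simp
next
  case False
  have "0 \<le> c"
  proof (rule ccontr)
    assume "\<not> 0 \<le> c"
    then have c: "c < 0" by simp
    have *: "0 \<le> 2 * a + 2 * c * t\<^sup>2" for t
      using nonneg[of t] nonneg[of "- t"] by simp
    have a: "0 \<le> a" using nonneg[of 0] by simp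
    \<comment> \<open>This t makes 2 a + 2 c t^2 equal to -2.\<close>
    have "2 * c * (sqrt ((a + 1) / (- c)))\<^sup>2 = - 2 * (a + 1)"
      using a c by (simp add: divide_nonneg_pos field_simps)
    then show False using *[of "sqrt ((a + 1) / (- c))"] by simp
  qed
  then have c: "0 < c" using False by simp
  have "a + 2 * b * (- b / c) + c * (- b / c)\<^sup>2 = a - b\<^sup>2 / c"
    using c by (simp add: field_simps power2_eq_square)
  then have "b\<^sup>2 / c \<le> a" using nonneg[of "- b / c"] by simp
  then show ?thesis using c by (simp add: field_simps)
qed

lemma psd_Cauchy_Schwarz:
  assumes "psd P"
  shows "(P x \<bullet> y)\<^sup>2 \<le> (P x \<bullet> x) * (P y \<bullet> y)"
proof (rule nonneg_quadratic_discriminant)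
  fix t :: real
  interpret bounded_linear P by (rule psdD[OF assms])
  have "P (x + t *\<^sub>R y) \<bullet> (x + t *\<^sub>R y)
      = P x \<bullet> x + 2 * (P x \<bullet> y) * t + (P y \<bullet> y) * t\<^sup>2"
    using psdD(2)[OF assms, of y x]
    by (simp add: add scaleR inner_simps inner_commute power2_eq_square algebra_simps)
  then show "0 \<le> P x \<bullet> x + 2 * (P x \<bullet> y) * t + (P y \<bullet> y) * t\<^sup>2"
    using psdD(3)[OF assms, of "x + t *\<^sub>R y"] by simp
qed

text \<open>Cauchy-Schwarz for the form of P at x and P x, divided by the squared norm of P x. In
  operator terms, P^2 <= \<open>onorm P\<close> P.\<close>

lemma psd_norm_bound:
  assumes "psd P"
  shows "(norm (P x))\<^sup>2 \<le> onorm P * (P x \<bullet> x)"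
proof (cases "P x = 0")
  case False
  have "((norm (P x))\<^sup>2)\<^sup>2 \<le> (P x \<bullet> x) * (P (P x) \<bullet> P x)"
    using psd_Cauchy_Schwarz[OF assms, of x "P x"] by (simp add: power2_norm_eq_inner)
  also have "\<dots> \<le> (P x \<bullet> x) * (onorm P * norm (P x) * norm (P x))"
    by (intro mult_left_mono order_trans[OF norm_cauchy_schwarz] mult_right_mono
        onorm psdD[OF assms]) simp
  finally have "(norm (P x))\<^sup>2 * (norm (P x))\<^sup>2 \<le> (norm (P x))\<^sup>2 * (onorm P * (P x \<bullet> x))"
    by (simp add: power2_eq_square mult_ac)
  then show ?thesis
    using False mult_le_cancel_left_pos[of "(norm (P x))\<^sup>2"]
    by (metis zero_less_norm_iff zero_less_power)
qed simp

lemma psd_eq_0: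
  assumes "psd P" and "P x \<bullet> x = 0"
  shows "P x = 0"
  using psd_norm_bound[OF assms(1), of x] assms(2) by simp

text \<open>By P^2 <= s P, the quadratic term of the expanded square is at most half of the cross
  term. This serves both the square root iteration and \<open>psd_resolvent\<close>.\<close>

lemma psd_contraction:
  assumes "psd P" and s: "0 < s" "onorm P \<le> s"
  shows "norm (x - P x /\<^sub>R s) \<le> norm x"
proof -
  have pos: "0 \<le> P x \<bullet> x" by (rule psdD[OF assms(1)])
  have "(norm (P x))\<^sup>2 \<le> s * (P x \<bullet> x)"
    using psd_norm_bound[OF assms(1), of x] mult_right_mono[OF s(2) pos] by simp
  then have "(norm (P x))\<^sup>2 / s\<^sup>2 \<le> (P x \<bullet> x) / s"
    using s(1) by (simp add: field_simps power2_eq_square)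
  moreover have "(norm (x - P x /\<^sub>R s))\<^sup>2
      = (norm x)\<^sup>2 - 2 * (P x \<bullet> x) / s + (norm (P x))\<^sup>2 / s\<^sup>2"
    unfolding power2_norm_eq_inner using s(1)
    by (simp add: inner_simps inner_commute field_simps power2_eq_square)
  moreover have "0 \<le> (P x \<bullet> x) / s" using pos s(1) by simp
  ultimately have "(norm (x - P x /\<^sub>R s))\<^sup>2 \<le> (norm x)\<^sup>2" by simp
  then show ?thesis by (simp add: power2_le_iff_abs_le)
qed

section \<open>Square roots\<close>

text \<open>
  A fixed point \<open>Y\<close> of \<open>Y \<mapsto> (C + Y\<^sup>2) / 2\<close> satisfies \<open>(1 - Y)\<^sup>2 = 1 - C\<close>.
\<close>

primrec sqrt_iter :: "('a \<Rightarrow>\<^sub>L 'a) \<Rightarrow> nat \<Rightarrow> ('a::real_normed_vector \<Rightarrow>\<^sub>L 'a)"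
  where
    "sqrt_iter C 0 = 0"
  | "sqrt_iter C (Suc n) = (1/2) *\<^sub>R (C + (sqrt_iter C n o\<^sub>L sqrt_iter C n))"

text \<open>The same iteration for the scalar \<open>C = 1\<close>, which majorizes the one above.\<close>

primrec unit_iter :: "nat \<Rightarrow> real"
  where
    "unit_iter 0 = 0"
  | "unit_iter (Suc n) = (1 + (unit_iter n)\<^sup>2) / 2"

lemma unit_iter_bounds: "0 \<le> unit_iter n \<and> unit_iter n \<le> 1"
  by (induction n) (auto simp: power_le_one)

lemma unit_iter_Suc_ge: "unit_iter n \<le> unit_iter (Suc n)"
  using zero_le_power2[of "1 - unit_iter n"] by (simp add: power2_eq_square algebra_simps)

lemma Cauchy_unit_iter: "Cauchy unit_iter"
proof -
  have "incseq unit_iter" by (intro incseq_SucI unit_iter_Suc_ge)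
  then have "convergent unit_iter"
    using unit_iter_bounds incseq_convergent[of unit_iter 1] unfolding convergent_def by metis
  then show ?thesis by (rule convergent_Cauchy)
qed

text \<open>Each iterate is a polynomial in C, and the same polynomial in D. T may connect different
  spaces.\<close>

lemma sqrt_iter_intertwine:
  assumes "T o\<^sub>L C = D o\<^sub>L T"
  shows "T o\<^sub>L sqrt_iter C n = sqrt_iter D n o\<^sub>L T"
proof (induction n)
  case (Suc n)
  have "T (sqrt_iter C n (sqrt_iter C n x)) = sqrt_iter D n (sqrt_iter D n (T x))" for x
    using Suc by (metis blinfun_apply_blinfun_compose)
  moreover have "T (C x) = D (T x)" for x
    using assms by (metis blinfun_apply_blinfun_compose)
  ultimately show ?case
    by (intro blinfun_eqI) (simp add: blinfun.bilinear_simps)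
qed (auto intro!: blinfun_eqI simp: blinfun.bilinear_simps)

lemma norm_sqrt_iter_le:
  assumes "norm C \<le> 1"
  shows "norm (sqrt_iter C n) \<le> unit_iter n"
proof (induction n)
  case (Suc n)
  have "norm (sqrt_iter C n o\<^sub>L sqrt_iter C n) \<le> (unit_iter n)\<^sup>2"
    using norm_blinfun_compose mult_mono[OF Suc Suc] unit_iter_bounds[of n]
    by (fastforce simp: power2_eq_square intro: order_trans)
  then show ?case
    using norm_triangle_ineq[of C "sqrt_iter C n o\<^sub>L sqrt_iter C n"] assms by simp
qed simp

text \<open>Successive iterates Y, Z commute, so Z^2 - Y^2 = (Z - Y)(Z + Y). The factors are bounded
  by v - u and v + u, and (v - u)(v + u)/2 is the next scalar increment.\<close>

lemma norm_sqrt_iter_Suc_diff_le: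
  assumes "norm C \<le> 1"
  shows "norm (sqrt_iter C (Suc n) - sqrt_iter C n) \<le> unit_iter (Suc n) - unit_iter n"
proof (induction n)
  case 0
  then show ?case using assms by simp
next
  case (Suc n)
  define Y Z where "Y = sqrt_iter C n" and "Z = sqrt_iter C (Suc n)"
  define u v where "u = unit_iter n" and "v = unit_iter (Suc n)"
  have Z: "Z = (1/2) *\<^sub>R (C + (Y o\<^sub>L Y))"
    and Suc_Suc: "sqrt_iter C (Suc (Suc n)) = (1/2) *\<^sub>R (C + (Z o\<^sub>L Z))"
    by (simp_all add: Y_def Z_def)
  have v: "v = (1 + u\<^sup>2) / 2" and v_Suc: "unit_iter (Suc (Suc n)) = (1 + v\<^sup>2) / 2"
    by (simp_all add: u_def v_def)
  \<comment> \<open>Intertwining twice: C commutes with Y, hence Y commutes with Z.\<close>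
  have "Y o\<^sub>L C = C o\<^sub>L Y"
    unfolding Y_def by (rule sqrt_iter_intertwine[OF refl, symmetric])
  then have "Y o\<^sub>L Z = Z o\<^sub>L Y" unfolding Z_def by (rule sqrt_iter_intertwine)
  then have comm: "Y (Z x) = Z (Y x)" for x by (metis blinfun_apply_blinfun_compose)
  have "sqrt_iter C (Suc (Suc n)) - Z
      = (1/2) *\<^sub>R ((C + (Z o\<^sub>L Z)) - (C + (Y o\<^sub>L Y)))"
    by (metis Suc_Suc Z scaleR_diff_right)
  also have "\<dots> = (1/2) *\<^sub>R ((Z - Y) o\<^sub>L (Z + Y))"
    by (rule blinfun_eqI) (simp add: blinfun.bilinear_simps comm)
  finally have "norm (sqrt_iter C (Suc (Suc n)) - Z) \<le> norm (Z - Y) * norm (Z + Y) / 2"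
    using norm_blinfun_compose[of "Z - Y" "Z + Y"] by simp
  also have "\<dots> \<le> (v - u) * (v + u) / 2"
  proof -
    have "norm (Z - Y) \<le> v - u" using Suc by (simp only: Y_def Z_def u_def v_def)
    moreover have "norm (Z + Y) \<le> v + u"
      using norm_triangle_mono[OF norm_sqrt_iter_le[OF assms] norm_sqrt_iter_le[OF assms]]
      by (simp only: Y_def Z_def u_def v_def)
    ultimately show ?thesis
      by (intro divide_right_mono mult_mono') auto
  qed
  also have "\<dots> = unit_iter (Suc (Suc n)) - v"
    unfolding v_Suc using v by (simp add: power2_eq_square field_simps)
  finally show ?case by (simp only: Z_def v_def)
qed

lemma norm_sqrt_iter_diff_le:
  assumes "norm C \<le> 1"
  shows "norm (sqrt_iter C (n + k) - sqrt_iter C n) \<le> unit_iter (n + k) - unit_iter n"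
proof (induction k)
  case (Suc k)
  have "norm (sqrt_iter C (n + Suc k) - sqrt_iter C n)
      \<le> norm (sqrt_iter C (Suc (n + k)) - sqrt_iter C (n + k))
        + norm (sqrt_iter C (n + k) - sqrt_iter C n)"
    by (metis add_Suc_right diff_add_cancel diff_diff_eq2 norm_triangle_ineq add_diff_eq)
  then show ?case
    using norm_sqrt_iter_Suc_diff_le[OF assms, of "n + k"] Suc
    by (simp del: sqrt_iter.simps unit_iter.simps)
qed simp

text \<open>The Cauchy property comes from the scalar majorant. This covers norm 1, where Y to (C +
  Y^2)/2 need not be a strict contraction of the unit ball.\<close>

lemma sqrt_iter_tendsto:
  fixes C :: "'a::banach \<Rightarrow>\<^sub>L 'a"
  assumes "norm C \<le> 1"
  shows "sqrt_iter C \<longlonglongrightarrow> lim (sqrt_iter C)"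
proof -
  have "Cauchy (sqrt_iter C)"
  proof (rule CauchyI')
    fix e :: real
    assume "0 < e"
    then obtain M where M: "\<And>m n. M \<le> m \<Longrightarrow> M \<le> n \<Longrightarrow> norm (unit_iter m - unit_iter n) < e"
      using Cauchy_unit_iter unfolding Cauchy_iff by meson
    have "norm (sqrt_iter C m - sqrt_iter C n) < e" if "M \<le> m" "m < n" for m n
    proof -
      obtain k where k: "n = m + k" using \<open>m < n\<close> less_imp_add_positive by blast
      have "norm (sqrt_iter C m - sqrt_iter C n) \<le> unit_iter n - unit_iter m"
        using norm_sqrt_iter_diff_le[OF assms, of m k] by (simp add: k norm_minus_commute)
      then show ?thesis using M[of n m] that by auto
    qed
    then show "\<exists>M. \<forall>m\<ge>M. \<forall>n>m. dist (sqrt_iter C m) (sqrt_iter C n) < e"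
      unfolding dist_norm by blast
  qed
  then show ?thesis by (simp add: Cauchy_convergent_iff convergent_LIMSEQ_iff)
qed

text \<open>For C = 1 - P/s, a fixed point Y of the iteration has (1 - Y)^2 = P/s. The operator is
  bundled because the limit is taken in operator norm.\<close>

definition defect :: "real \<Rightarrow> ('a \<Rightarrow> 'a) \<Rightarrow> 'a::real_normed_vector \<Rightarrow>\<^sub>L 'a"
  where "defect s P = Blinfun (\<lambda>x. x - P x /\<^sub>R s)"

text \<open>The scale \<open>s\<close> must be positive and at least \<open>onorm P\<close>; the value does not depend on it.\<close>

definition psd_sqrt :: "real \<Rightarrow> ('a \<Rightarrow> 'a) \<Rightarrow> 'a::banach \<Rightarrow> 'a"
  where "psd_sqrt s P x = sqrt s *\<^sub>R (x - lim (sqrt_iter (defect s P)) x)"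

lemma defect_apply:
  assumes "bounded_linear P"
  shows "defect s P x = x - P x /\<^sub>R s"
  unfolding defect_def
  by (subst bounded_linear_Blinfun_apply)
    (auto intro!: bounded_linear_intros assms)

lemma norm_defect_le:
  assumes "psd P" "0 < s" "onorm P \<le> s"
  shows "norm (defect s P) \<le> 1"
  by (rule norm_blinfun_bound)
    (use psd_contraction[OF assms] psdD(1)[OF assms(1)] in \<open>auto simp: defect_apply\<close>)

text \<open>The common scale s lets T intertwine the defects, hence the iterates and their limits.
  It is used with T another root of P (uniqueness), a complex scalar (complex linearity), and the
  given operator (relating its two absolute values).\<close>

lemma psd_sqrt_intertwine:
  fixes P :: "'a::{real_inner,banach} \<Rightarrow> 'a" and Q :: "'b::{real_inner,banach} \<Rightarrow> 'b"
  assumes P: "psd P" "onorm P \<le> s" and Q: "psd Q" "onorm Q \<le> s" and s: "0 < s"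
    and T: "bounded_linear T" "\<And>x. T (P x) = Q (T x)"
  shows "T (psd_sqrt s P x) = psd_sqrt s Q (T x)"
proof -
  interpret T: bounded_linear T by (rule T)
  let ?C = "defect s P" and ?D = "defect s Q"
  have "Blinfun T o\<^sub>L ?C = ?D o\<^sub>L Blinfun T"
    by (rule blinfun_eqI)
      (simp add: bounded_linear_Blinfun_apply T defect_apply psdD(1) P Q T.diff T.scaleR)
  then have "T (sqrt_iter ?C n x) = sqrt_iter ?D n (T x)" for n
    using sqrt_iter_intertwine[of "Blinfun T" ?C ?D n]
    by (metis T(1) blinfun_apply_blinfun_compose bounded_linear_Blinfun_apply)
  moreover have "(\<lambda>n. T (sqrt_iter ?C n x)) \<longlonglongrightarrow> T (lim (sqrt_iter ?C) x)"
    by (intro T.tendsto blinfun.tendsto sqrt_iter_tendsto norm_defect_le P s tendsto_const)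
  moreover have "(\<lambda>n. sqrt_iter ?D n (T x)) \<longlonglongrightarrow> lim (sqrt_iter ?D) (T x)"
    by (intro blinfun.tendsto sqrt_iter_tendsto norm_defect_le Q s tendsto_const)
  ultimately have "T (lim (sqrt_iter ?C) x) = lim (sqrt_iter ?D) (T x)"
    using LIMSEQ_unique by simp
  then show ?thesis by (simp add: psd_sqrt_def T.diff T.scaleR)
qed

text \<open>The recursion passes to the limit as 2 Y = C + Y^2. Symmetry and norm at most 1 are
  inherited from the iterates, and the norm bound makes 1 - Y positive.\<close>

lemma
  fixes P :: "'a::{real_inner,banach} \<Rightarrow> 'a"
  assumes P: "psd P" and s: "0 < s" "onorm P \<le> s"
  shows psd_psd_sqrt: "psd (psd_sqrt s P)"
    and psd_sqrt_sqrt: "psd_sqrt s P (psd_sqrt s P x) = P x"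
proof -
  define C where "C = defect s P"
  define Y where "Y = lim (sqrt_iter C)"
  have C: "C x = x - P x /\<^sub>R s" for x by (simp add: C_def defect_apply psdD(1)[OF P])
  have norm_C: "norm C \<le> 1" unfolding C_def by (intro norm_defect_le P s)
  have lim: "sqrt_iter C \<longlonglongrightarrow> Y" unfolding Y_def by (rule sqrt_iter_tendsto[OF norm_C])
  have "(\<lambda>n. sqrt_iter C (Suc n)) \<longlonglongrightarrow> (1/2) *\<^sub>R (C + (Y o\<^sub>L Y))"
    unfolding sqrt_iter.simps
    by (intro tendsto_intros lim bounded_bilinear.tendsto[OF bounded_bilinear_blinfun_compose])
  then have Y: "Y = (1/2) *\<^sub>R (C + (Y o\<^sub>L Y))"
    using LIMSEQ_Suc[OF lim] LIMSEQ_unique by blast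
  have YY: "Y (Y x) = 2 *\<^sub>R Y x - C x" for x
    by (subst (3) Y) (simp add: blinfun.bilinear_simps)
  have "norm (sqrt_iter C n) \<le> 1" for n
    using norm_sqrt_iter_le[OF norm_C, of n] unit_iter_bounds[of n] by linarith
  then have norm_Y: "norm Y \<le> 1"
    by (intro Lim_norm_ubound[OF _ lim] always_eventually) auto
  have C_sym: "C x \<bullet> y = x \<bullet> C y" for x y
    using psdD(2)[OF P, of x y] by (simp add: C inner_simps)
  have iter_sym: "sqrt_iter C n x \<bullet> y = x \<bullet> sqrt_iter C n y" for n x y
    by (induction n arbitrary: x y) (simp_all add: blinfun.bilinear_simps inner_simps C_sym)
  have Y_sym: "Y x \<bullet> y = x \<bullet> Y y" for x y
  proof (rule LIMSEQ_unique)
    show "(\<lambda>n. sqrt_iter C n x \<bullet> y) \<longlonglongrightarrow> Y x \<bullet> y"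
      by (intro tendsto_intros lim blinfun.tendsto)
    show "(\<lambda>n. sqrt_iter C n x \<bullet> y) \<longlonglongrightarrow> x \<bullet> Y y"
      unfolding iter_sym by (intro tendsto_intros lim blinfun.tendsto)
  qed
  have S: "psd_sqrt s P = (\<lambda>x. sqrt s *\<^sub>R (x - Y x))"
    by (simp add: fun_eq_iff psd_sqrt_def Y_def C_def)
  have "Y x \<bullet> x \<le> x \<bullet> x" for x
  proof -
    have "Y x \<bullet> x \<le> norm (Y x) * norm x" by (rule norm_cauchy_schwarz)
    also have "\<dots> \<le> norm x * norm x"
      using norm_blinfun[of Y x] mult_right_mono[OF norm_Y, of "norm x"]
      by (intro mult_right_mono) auto
    finally show ?thesis by (simp add: dot_square_norm power2_eq_square)
  qed
  then show "psd (psd_sqrt s P)"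
    unfolding psd_def S
    by (auto intro!: bounded_linear_intros mult_nonneg_nonneg simp: inner_simps Y_sym s less_imp_le)
  show "psd_sqrt s P (psd_sqrt s P x) = P x"
    using s by (simp add: S blinfun.bilinear_simps YY C algebra_simps scaleR_2)
qed

text \<open>S commutes with S^2 = P, hence with the constructed root R. For y = (R - S) x this gives
  (R + S) y = 0, so both nonnegative forms vanish at y; then R y = S y = 0, and y is orthogonal to R
  x - S x, that is, to itself.\<close>

lemma psd_sqrt_unique:
  fixes P :: "'a::{real_inner,banach} \<Rightarrow> 'a"
  assumes P: "psd P" and s: "0 < s" "onorm P \<le> s"
    and S: "psd S" "\<And>x. S (S x) = P x"
  shows "S = psd_sqrt s P"
proof
  fix x
  define R where "R = psd_sqrt s P"
  have R: "psd R" "\<And>x. R (R x) = P x"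
    unfolding R_def by (rule psd_psd_sqrt[OF P s], rule psd_sqrt_sqrt[OF P s])
  interpret S: bounded_linear S by (rule psdD[OF S(1)])
  interpret R: bounded_linear R by (rule psdD[OF R(1)])
  have comm: "S (R x) = R (S x)" for x
    unfolding R_def by (intro psd_sqrt_intertwine P s psdD(1)[OF S(1)]) (simp add: S(2)[symmetric])
  define y where "y = R x - S x"
  have "R y + S y = 0" by (simp add: y_def R.diff S.diff comm R(2) S(2))
  then have "R y \<bullet> y + S y \<bullet> y = 0" by (simp flip: inner_add_left)
  then have "R y \<bullet> y = 0" "S y \<bullet> y = 0"
    using psdD(3)[OF R(1), of y] psdD(3)[OF S(1), of y] by auto
  then have "R y = 0" "S y = 0" using psd_eq_0 R(1) S(1) by auto
  then have "y \<bullet> y = 0"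
    using psdD(2)[OF R(1), of x y] psdD(2)[OF S(1), of x y]
    by (subst (1) y_def) (simp add: inner_simps)
  then show "S x = R x" by (simp add: y_def)
qed

section \<open>The mixed Schwarz inequality\<close>

text \<open>The equation is the fixed point problem w = s/(s + e) (w - P w / s + x / s), where 1 -
  P/s does not increase norms.\<close>

lemma psd_resolvent:
  fixes P :: "'a::{real_inner,banach} \<Rightarrow> 'a"
  assumes P: "psd P" and e: "0 < e"
  obtains w where "P w + e *\<^sub>R w = x"
proof -
  interpret P: bounded_linear P by (rule psdD[OF P])
  define s where "s = onorm P + 1"
  have s: "0 < s" "onorm P \<le> s" using onorm_pos_le[OF psdD(1)[OF P]] by (auto simp: s_def)
  define c where "c = s / (s + e)"
  have c: "0 \<le> c" "c < 1" using s e by (auto simp: c_def)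
  define f where "f w = c *\<^sub>R (w - P w /\<^sub>R s + x /\<^sub>R s)" for w
  have "dist (f v) (f w) \<le> c * dist v w" for v w
  proof -
    have "f v - f w = c *\<^sub>R ((v - w) - P (v - w) /\<^sub>R s)"
      by (simp add: f_def P.diff algebra_simps)
    then show ?thesis
      using c psd_contraction[OF P s, of "v - w"] by (simp add: dist_norm mult_left_mono)
  qed
  then obtain w where w: "f w = w"
    using banach_fix_type[OF c, of f] by blast
  have "(s + e) *\<^sub>R w = (s + e) *\<^sub>R f w" by (simp add: w)
  also have "\<dots> = s *\<^sub>R (w - P w /\<^sub>R s + x /\<^sub>R s)"
    using s e by (simp add: f_def c_def)
  also have "\<dots> = s *\<^sub>R w - P w + x"
    using s by (simp add: algebra_simps)
  finally have "P w + e *\<^sub>R w = x" by (simp add: algebra_simps)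
  then show ?thesis by (rule that)
qed

lemma mixed_Schwarz_real:
  fixes A :: "'a::{real_inner,banach} \<Rightarrow> 'b::{real_inner,banach}"
  assumes A: "bounded_linear A" and adj: "\<And>x y. A x \<bullet> y = x \<bullet> A' y"
    and P: "psd P" "\<And>x. P (P x) = A' (A x)"
    and Q: "psd Q" and AP: "\<And>x. A (P x) = Q (A x)"
  shows "(A x \<bullet> y)\<^sup>2 \<le> (P x \<bullet> x) * (Q y \<bullet> y)"
proof -
  interpret A: bounded_linear A by (rule A)
  interpret P: bounded_linear P by (rule psdD[OF P(1)])
  have norm_A: "norm (A x) = norm (P x)" for x
    by (simp add: norm_eq_sqrt_inner adj psdD(2)[OF P(1)] P(2))
  \<comment> \<open>For \<open>x\<close> in the range of \<open>P\<close> the intertwining moves \<open>A\<close> past \<open>P\<close>; the resolvent reduces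
    the general case to this one, up to an error of order \<open>e\<close>.\<close>
  have range: "(A (P w) \<bullet> y)\<^sup>2 \<le> (P (P w) \<bullet> P w) * (Q y \<bullet> y)" for w
  proof -
    have "Q (A w) \<bullet> A w = P (P w) \<bullet> P w"
      by (metis AP P adj inner_commute psdD(2))
    then show ?thesis
      using psd_Cauchy_Schwarz[OF Q, of "A w" y] by (simp add: AP)
  qed
  let ?r = "sqrt ((P x \<bullet> x) * (Q y \<bullet> y))"
  have "\<bar>A x \<bullet> y\<bar> \<le> ?r + e" if "0 < e" for e
  proof -
    \<comment> \<open>Chosen so that d (norm x norm y + 1) = e; the 1 keeps the denominator
      positive.\<close>
    define d where "d = e / (norm x * norm y + 1)"
    have den: "0 < norm x * norm y + 1" by (simp add: add_nonneg_pos)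
    have d: "0 < d" using that den by (simp add: d_def)
    obtain w where w: "P w + d *\<^sub>R w = x" using psd_resolvent[OF P(1) d] by blast
    define z where "z = P w"
    have x: "x = z + d *\<^sub>R w" using w by (simp add: z_def)
    have sym: "P z \<bullet> w = z \<bullet> z" "P w \<bullet> z = z \<bullet> z" "z \<bullet> w = P w \<bullet> w"
      by (simp_all add: z_def psdD(2)[OF P(1)] inner_commute)
    \<comment> \<open>All three terms are nonnegative, so the form of P only decreases from x to z;
      the norm does likewise.\<close>
    have "P x \<bullet> x = P z \<bullet> z + 2 * d * (z \<bullet> z) + d\<^sup>2 * (P w \<bullet> w)"
      by (simp add: x P.add P.scaleR inner_simps sym power2_eq_square algebra_simps)
    then have le: "P z \<bullet> z \<le> P x \<bullet> x"
      using d psdD(3)[OF P(1), of w] by simp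
    have "(norm x)\<^sup>2 = (norm z)\<^sup>2 + 2 * d * (P w \<bullet> w) + d\<^sup>2 * (norm w)\<^sup>2"
      unfolding power2_norm_eq_inner using sym(3) inner_commute[of w z]
      by (simp add: x inner_simps power2_eq_square algebra_simps)
    then have "(norm z)\<^sup>2 \<le> (norm x)\<^sup>2"
      using d psdD(3)[OF P(1), of w] by simp
    then have z_le: "norm z \<le> norm x" by (simp add: power2_le_iff_abs_le)
    have "(A z \<bullet> y)\<^sup>2 \<le> (P x \<bullet> x) * (Q y \<bullet> y)"
      using range[of w] mult_right_mono[OF le psdD(3)[OF Q, of y]] by (simp add: z_def)
    then have "\<bar>A z \<bullet> y\<bar> \<le> ?r" by (metis real_sqrt_abs real_sqrt_le_mono)
    moreover have "\<bar>d * (A w \<bullet> y)\<bar> \<le> e"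
    proof -
      \<comment> \<open>The norm of w may grow as d shrinks, but A w has the norm of P w = z, which
        is at most that of x.\<close>
      have "\<bar>A w \<bullet> y\<bar> \<le> norm z * norm y"
        using Cauchy_Schwarz_ineq2[of "A w" y] by (simp add: norm_A z_def)
      also have "\<dots> \<le> norm x * norm y + 1"
        using mult_right_mono[OF z_le, of "norm y"] by simp
      finally have "d * \<bar>A w \<bullet> y\<bar> \<le> d * (norm x * norm y + 1)"
        using d by (intro mult_left_mono) auto
      also have "\<dots> = e" using den by (simp add: d_def)
      finally show ?thesis using d by (simp add: abs_mult)
    qed
    moreover have "A x \<bullet> y = A z \<bullet> y + d * (A w \<bullet> y)"
      by (simp add: x A.add A.scaleR inner_simps)
    ultimately show ?thesis by linarith
  qed
  then have "\<bar>A x \<bullet> y\<bar> \<le> ?r" by (rule field_le_epsilon)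
  then have "\<bar>A x \<bullet> y\<bar>\<^sup>2 \<le> ?r\<^sup>2" by (rule power_mono) simp
  then show ?thesis using psdD(3)[OF P(1), of x] psdD(3)[OF Q, of y] by simp
qed

section \<open>Adjoints\<close>

text \<open>The representing vector minimizes \<open>\<parallel>x\<parallel>\<^sup>2 - 2 f x\<close>.\<close>

lemma Riesz_representation_real:
  fixes f :: "'a::{real_inner,banach} \<Rightarrow> real"
  assumes "bounded_linear f"
  obtains u where "\<And>x. f x = x \<bullet> u"
proof -
  interpret f: bounded_linear f by (rule assms)
  define g where "g x = (norm x)\<^sup>2 - 2 * f x" for x
  have lower: "- (onorm f)\<^sup>2 \<le> g x" for x
  proof -
    have "\<bar>f x\<bar> \<le> onorm f * norm x" using onorm[OF assms, of x] by simp
    then show ?thesis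
      using zero_le_power2[of "norm x - onorm f"]
      by (simp add: g_def power2_eq_square algebra_simps abs_le_iff)
  qed
  define m where "m = Inf (range g)"
  have m_le: "m \<le> g x" for x
    unfolding m_def by (intro cInf_lower bdd_belowI2[of _ "- (onorm f)\<^sup>2"] lower) auto
  have "\<exists>x. g x < m + 1 / Suc n" for n
    using cInf_lessD[of "range g" "m + 1 / Suc n"] by (auto simp: m_def)
  then obtain X where X: "\<And>n. g (X n) < m + 1 / Suc n" by metis
  \<comment> \<open>Parallelogram law; the linear terms cancel. As the midpoint has value at least
    m, near-minimizers are close together.\<close>
  have para: "(norm (x - y))\<^sup>2 = 2 * g x + 2 * g y - 4 * g ((x + y) /\<^sub>R 2)" for x y
    unfolding g_def power2_norm_eq_inner
    by (simp add: f.add f.scaleR inner_simps inner_commute algebra_simps)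
  have "Cauchy X"
  proof (rule CauchyI')
    fix e :: real
    assume e: "0 < e"
    then obtain M :: nat where M: "4 / e\<^sup>2 < M" using reals_Archimedean2 by blast
    have "norm (X p - X q) < e" if "M \<le> p" "p < q" for p q
    proof -
      have small: "g (X k) < m + e\<^sup>2 / 4" if "M \<le> k" for k
      proof -
        have "4 / e\<^sup>2 < real (Suc k)" using M that by linarith
        then have "1 / Suc k < e\<^sup>2 / 4"
          using e by (simp add: field_simps)
        then show ?thesis using X[of k] by linarith
      qed
      have "(norm (X p - X q))\<^sup>2 < e\<^sup>2"
        unfolding para using small[of p] small[of q] that m_le[of "(X p + X q) /\<^sub>R 2"] by linarith
      then show ?thesis using e by (simp add: power2_less_imp_less)
    qed
    then show "\<exists>M. \<forall>p\<ge>M. \<forall>q>p. dist (X p) (X q) < e"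
      unfolding dist_norm by blast
  qed
  then obtain u where u: "X \<longlonglongrightarrow> u" using Cauchy_convergent convergent_def by blast
  have "(\<lambda>n. g (X n)) \<longlonglongrightarrow> g u"
    unfolding g_def by (intro tendsto_intros f.tendsto u)
  moreover have "(\<lambda>n. m + 1 / Suc n) \<longlonglongrightarrow> m + 0"
    by (intro tendsto_add tendsto_const LIMSEQ_inverse_real_of_nat[unfolded inverse_eq_divide])
  ultimately have "g u \<le> m + 0"
    by (rule LIMSEQ_le) (use X less_imp_le in blast)
  have "f x = x \<bullet> u" for x
  proof -
    \<comment> \<open>Minimality at u leaves constant term 0, so the discriminant bound annihilates
      the linear coefficient.\<close>
    have "0 \<le> 0 + 2 * (x \<bullet> u - f x) * t + (norm x)\<^sup>2 * t\<^sup>2" for t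
    proof -
      have "g (u + t *\<^sub>R x) = g u + 2 * (x \<bullet> u - f x) * t + (norm x)\<^sup>2 * t\<^sup>2"
        unfolding g_def power2_norm_eq_inner
        by (simp add: f.add f.scaleR inner_simps inner_commute power2_eq_square algebra_simps)
      then show ?thesis using m_le[of "u + t *\<^sub>R x"] \<open>g u \<le> m + 0\<close> by simp
    qed
    then have "(x \<bullet> u - f x)\<^sup>2 \<le> 0 * (norm x)\<^sup>2" by (rule nonneg_quadratic_discriminant)
    then show ?thesis by simp
  qed
  then show ?thesis by (rule that)
qed

section \<open>The complex inner product and its real part\<close>

instance complex_hilbert_space \<subseteq> banach ..

lemma cinner_add_right: "cinner x (y + z) = cinner x y + cinner x z"
  by (metis cinner_add_left cinner_commute complex_cnj_add)

lemma cinner_scaleC_right: "cinner x (c *\<^sub>C y) = cnj c * cinner x y"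
  by (metis cinner_commute cinner_scaleC_left complex_cnj_mult)

lemma cinner_scaleR_left: "cinner (r *\<^sub>R x) y = r * cinner x y"
  by (simp flip: scaleC_of_real add: cinner_scaleC_left)

lemma cinner_scaleR_right: "cinner x (r *\<^sub>R y) = r * cinner x y"
  by (simp flip: scaleC_of_real add: cinner_scaleC_right)

lemma cinner_diff_left: "cinner (x - y) z = cinner x z - cinner y z"
  using cinner_add_left[of "x - y" y z] by simp

lemma cinner_diff_right: "cinner x (y - z) = cinner x y - cinner x z"
  using cinner_add_right[of x "y - z" z] by simp

text \<open>As Re (i z) = - Im z, the real inner product determines the complex one; this carries
  real results over.\<close>

lemma Im_cinner: "Im (cinner x y) = - ((\<i> *\<^sub>C x) \<bullet> y)"
  by (simp add: cinner_scaleC_left flip: Re_cinner)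

lemma norm_scaleC: "norm (c *\<^sub>C x) = cmod c * norm x"
proof -
  have "complex_of_real ((norm (c *\<^sub>C x))\<^sup>2) = complex_of_real ((cmod c * norm x)\<^sup>2)"
    by (simp only: cinner_self[symmetric] cinner_scaleC_left cinner_scaleC_right)
      (simp add: cinner_self complex_norm_square power_mult_distrib mult.assoc[symmetric]
        del: of_real_power)
  then show ?thesis by (simp only: of_real_eq_iff) simp
qed

lemma bounded_linear_scaleC: "bounded_linear (\<lambda>x. c *\<^sub>C x)"
proof (rule bounded_linear_intro[where K = "cmod c"])
  show "c *\<^sub>C r *\<^sub>R x = r *\<^sub>R c *\<^sub>C x" for r and x :: 'a
    by (simp flip: scaleC_of_real add: scaleC_scaleC mult.commute)
qed (simp_all add: scaleC_add_right norm_scaleC mult.commute)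

lemma cinner_eqI:
  assumes "\<And>x. cinner x y = cinner x z"
  shows "y = z"
proof -
  have "cinner (y - z) (y - z) = 0" using assms[of "y - z"] by (simp add: cinner_diff_right)
  then show ?thesis by (simp add: cinner_self_eq_0_iff)
qed

text \<open>Rotating x turns a modulus into a real part, to which real estimates apply.\<close>

lemma cinner_phase:
  obtains c where "cmod c = 1" and "cinner (c *\<^sub>C x) y = cmod (cinner x y)"
proof (cases "cinner x y = 0")
  case True
  then show ?thesis using that[of 1] by (simp add: cinner_scaleC_left)
next
  case False
  let ?c = "cnj (cinner x y) / cmod (cinner x y)"
  have "cmod ?c = 1" using False by (simp add: norm_divide)
  moreover have "cinner (?c *\<^sub>C x) y = cmod (cinner x y)"
    using False complex_norm_square[of "cinner x y"]
    by (simp add: cinner_scaleC_left field_simps power2_eq_square)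
  ultimately show ?thesis by (rule that)
qed

lemma complex_Cauchy_Schwarz: "cmod (cinner x y) \<le> norm x * norm y"
proof -
  obtain c where c: "cmod c = 1" "cinner (c *\<^sub>C x) y = cmod (cinner x y)"
    by (rule cinner_phase)
  have "cmod (cinner x y) = (c *\<^sub>C x) \<bullet> y" by (simp add: c flip: Re_cinner)
  also have "\<dots> \<le> norm x * norm y"
    using norm_cauchy_schwarz[of "c *\<^sub>C x" y] by (simp add: norm_scaleC c)
  finally show ?thesis .
qed

section \<open>Complex linear operators and their adjoints\<close>

lemma bounded_clinearD:
  assumes "bounded_clinear T"
  shows "bounded_linear T" "T (c *\<^sub>C x) = c *\<^sub>C T x"
  using assms by (auto simp: bounded_clinear_def)

lemma cadjoint_eqI:
  assumes "\<And>x y. cinner (T x) y = cinner x (S y)"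
  shows "cadjoint T = S"
  unfolding cadjoint_def
proof (rule the_equality)
  show "R = S" if "\<forall>x y. cinner (T x) y = cinner x (R y)" for R
  proof
    fix y
    show "R y = S y" by (rule cinner_eqI) (simp flip: assms that[rule_format])
  qed
qed (simp add: assms)

text \<open>The real Riesz theorem yields an adjoint for the real inner product. Since T commutes
  with i, it also matches imaginary parts.\<close>

lemma cinner_cadjoint:
  assumes T: "bounded_clinear T"
  shows "cinner (T x) y = cinner x (cadjoint T y)"
proof -
  have "\<exists>u. \<forall>x. T x \<bullet> y = x \<bullet> u" for y
  proof -
    have "bounded_linear (\<lambda>x. T x \<bullet> y)"
      by (intro bounded_linear_intros bounded_clinearD[OF T])
    then show ?thesis by (rule Riesz_representation_real) blast
  qed
  then obtain S where S: "\<And>x y. T x \<bullet> y = x \<bullet> S y" by metis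
  have "cinner (T x) y = cinner x (S y)" for x y
    by (rule complex_eqI) (simp_all add: Re_cinner Im_cinner S flip: bounded_clinearD(2)[OF T])
  then show ?thesis using cadjoint_eqI[of T S] by simp
qed

lemma cadjoint_cadjoint:
  assumes "bounded_clinear T"
  shows "cadjoint (cadjoint T) = T"
proof (rule cadjoint_eqI)
  fix y x
  have "cinner (cadjoint T y) x = cnj (cinner x (cadjoint T y))" by (rule cinner_commute)
  also have "\<dots> = cnj (cinner (T x) y)" by (simp only: cinner_cadjoint[OF assms])
  also have "\<dots> = cinner y (T x)" by (rule cinner_commute[symmetric])
  finally show "cinner (cadjoint T y) x = cinner y (T x)" .
qed

lemma norm_cadjoint_le:
  assumes T: "bounded_clinear T"
  shows "norm (cadjoint T y) \<le> onorm T * norm y"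
proof (cases "cadjoint T y = 0")
  case True
  then show ?thesis using onorm_pos_le[OF bounded_clinearD(1)[OF T]] by simp
next
  case False
  let ?z = "cadjoint T y"
  have "norm ?z * norm ?z = cmod (cinner (T ?z) y)"
    by (simp add: cinner_cadjoint[OF T] cinner_self power2_eq_square norm_mult)
  also have "\<dots> \<le> onorm T * norm ?z * norm y"
    by (intro order_trans[OF complex_Cauchy_Schwarz] mult_right_mono onorm bounded_clinearD[OF T])
      simp
  finally have "norm ?z * norm ?z \<le> norm ?z * (onorm T * norm y)" by (simp add: mult_ac)
  then show ?thesis using False by simp
qed

lemma bounded_clinear_cadjoint:
  assumes T: "bounded_clinear T"
  shows "bounded_clinear (cadjoint T)"
proof -
  have C: "cadjoint T (c *\<^sub>C x) = c *\<^sub>C cadjoint T x" for c x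
    by (rule cinner_eqI) (simp add: cinner_cadjoint[OF T, symmetric] cinner_scaleC_right)
  have "bounded_linear (cadjoint T)"
  proof (rule bounded_linear_intro[where K = "onorm T"])
    show "cadjoint T (x + y) = cadjoint T x + cadjoint T y" for x y
      by (rule cinner_eqI) (simp add: cinner_cadjoint[OF T, symmetric] cinner_add_right)
    show "cadjoint T (r *\<^sub>R x) = r *\<^sub>R cadjoint T x" for r x
      using C[of "complex_of_real r" x] by (simp add: scaleC_of_real)
  qed (use norm_cadjoint_le[OF T] in \<open>simp add: mult.commute\<close>)
  then show ?thesis using C by (simp add: bounded_clinear_def)
qed

lemma bounded_clinear_compose:
  assumes "bounded_clinear S" "bounded_clinear T"
  shows "bounded_clinear (S \<circ> T)"
  unfolding bounded_clinear_def o_def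
  using bounded_linear_compose[OF bounded_clinearD(1)[OF assms(1)] bounded_clinearD(1)[OF assms(2)]]
  by (simp add: bounded_clinearD(2)[OF assms(1)] bounded_clinearD(2)[OF assms(2)])

section \<open>Absolute values\<close>

text \<open>Polarization: the imaginary part of the form vanishes at x + y, so Im <T x, y> is
  antisymmetric in x and y; replacing x by i x turns this into real symmetry.\<close>

lemma positive_op_imp_psd:
  assumes T: "positive_op T"
  shows "psd T"
proof -
  have lin: "bounded_clinear T" and pos: "\<And>x. cinner (T x) x \<in> \<real>\<^sub>\<ge>\<^sub>0"
    using T by (auto simp: positive_op_def)
  interpret bounded_linear T by (rule bounded_clinearD[OF lin])
  have real: "Im (cinner (T x) x) = 0" for x
    using pos[of x] by (simp add: complex_nonneg_Reals_iff)
  have Im: "Im (cinner (T x) y) + Im (cinner (T y) x) = 0" for x y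
    using real[of "x + y"] by (simp add: add cinner_add_left cinner_add_right real)
  have "T x \<bullet> y = x \<bullet> T y" for x y
    using Im[of "\<i> *\<^sub>C x" y]
    by (simp add: bounded_clinearD[OF lin] cinner_scaleC_left cinner_scaleC_right Re_cinner
        inner_commute)
  moreover have "0 \<le> T x \<bullet> x" for x
    using pos[of x] by (simp add: complex_nonneg_Reals_iff Re_cinner)
  ultimately show ?thesis using bounded_clinearD[OF lin] by (simp add: psd_def)
qed

text \<open>S is symmetric and commutes with i, which is skew for the real inner product, so (i S x)
  . x equals its negative. This leads back from \<open>psd\<close> to
  \<open>positive_op\<close>.\<close>

lemma cinner_self_psd:
  assumes S: "psd S" and lin: "\<And>c x. S (c *\<^sub>C x) = c *\<^sub>C S x"
  shows "cinner (S x) x = complex_of_real (S x \<bullet> x)"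
proof (rule complex_eqI)
  have "(\<i> *\<^sub>C S x) \<bullet> x = S x \<bullet> (\<i> *\<^sub>C x)"
    by (metis S inner_commute lin psdD(2))
  moreover have "S x \<bullet> (\<i> *\<^sub>C x) = - ((\<i> *\<^sub>C S x) \<bullet> x)"
    by (simp add: cinner_scaleC_left cinner_scaleC_right flip: Re_cinner)
  ultimately show "Im (cinner (S x) x) = Im (complex_of_real (S x \<bullet> x))"
    by (simp add: Im_cinner)
qed (simp add: Re_cinner)

lemma op_sqrt_eq_psd_sqrt:
  assumes P: "positive_op P" and s: "0 < s" "onorm P \<le> s"
  shows "op_sqrt P = psd_sqrt s P"
  unfolding op_sqrt_def
proof (rule the_equality)
  have psd: "psd P" by (rule positive_op_imp_psd[OF P])
  have lin: "P (c *\<^sub>C x) = c *\<^sub>C P x" for c x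
    using P by (auto simp: positive_op_def bounded_clinear_def)
  let ?S = "psd_sqrt s P"
  have S: "psd ?S" by (rule psd_psd_sqrt[OF psd s])
  have S_lin: "?S (c *\<^sub>C x) = c *\<^sub>C ?S x" for c x
    by (rule psd_sqrt_intertwine[symmetric]) (use psd s lin bounded_linear_scaleC in auto)
  have "positive_op ?S"
    using psdD[OF S]
    by (simp add: positive_op_def bounded_clinear_def S_lin cinner_self_psd[OF S S_lin])
  then show "positive_op ?S \<and> ?S \<circ> ?S = P"
    using psd_sqrt_sqrt[OF psd s] by (simp add: fun_eq_iff)
  show "S = ?S" if "positive_op S \<and> S \<circ> S = P" for S
    using that by (intro psd_sqrt_unique[OF psd s] positive_op_imp_psd) auto
qed

lemma positive_op_cadjoint_self:
  assumes T: "bounded_clinear T"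
  shows "positive_op (cadjoint T \<circ> T)"
proof -
  have "cinner (cadjoint T (T x)) x = complex_of_real ((norm (T x))\<^sup>2)" for x
    by (metis cinner_cadjoint[OF bounded_clinear_cadjoint[OF T]] cadjoint_cadjoint[OF T] cinner_self)
  then show ?thesis
    by (simp add: positive_op_def T bounded_clinear_compose bounded_clinear_cadjoint
        del: of_real_power)
qed

lemma
  assumes T: "bounded_clinear T"
  shows psd_op_abs: "psd (op_abs T)"
    and op_abs_op_abs: "op_abs T (op_abs T x) = cadjoint T (T x)"
    and op_abs_scaleC: "op_abs T (c *\<^sub>C x) = c *\<^sub>C op_abs T x"
    and op_abs_intertwine: "T (op_abs T x) = op_abs (cadjoint T) (T x)"
proof -
  let ?P = "cadjoint T \<circ> T" and ?Q = "T \<circ> cadjoint T"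
  have pos: "positive_op ?P" "positive_op ?Q"
    using positive_op_cadjoint_self[OF T]
      positive_op_cadjoint_self[OF bounded_clinear_cadjoint[OF T]]
    by (simp_all add: cadjoint_cadjoint[OF T])
  note psd = pos[THEN positive_op_imp_psd]
  \<comment> \<open>One scale for both products, so that T ?P = ?Q T passes to the roots; the 1
    makes it positive.\<close>
  define s where "s = max 1 (max (onorm ?P) (onorm ?Q))"
  have s: "0 < s" "onorm ?P \<le> s" "onorm ?Q \<le> s" by (auto simp: s_def)
  have abs: "op_abs T = psd_sqrt s ?P"
    unfolding op_abs_def by (rule op_sqrt_eq_psd_sqrt[OF pos(1) s(1,2)])
  have abs': "op_abs (cadjoint T) = psd_sqrt s ?Q"
    unfolding op_abs_def cadjoint_cadjoint[OF T] by (rule op_sqrt_eq_psd_sqrt[OF pos(2) s(1,3)])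
  show "psd (op_abs T)" unfolding abs by (rule psd_psd_sqrt[OF psd(1) s(1,2)])
  show "op_abs T (op_abs T x) = cadjoint T (T x)"
    unfolding abs by (simp add: psd_sqrt_sqrt[OF psd(1) s(1,2)])
  show "op_abs T (c *\<^sub>C x) = c *\<^sub>C op_abs T x"
    unfolding abs
    by (rule psd_sqrt_intertwine[OF psd(1) s(2) psd(1) s(2,1) bounded_linear_scaleC, symmetric])
      (simp add: bounded_clinearD[OF T] bounded_clinearD[OF bounded_clinear_cadjoint[OF T]])
  show "T (op_abs T x) = op_abs (cadjoint T) (T x)"
    unfolding abs abs'
    by (rule psd_sqrt_intertwine[OF psd(1) s(2) psd(2) s(3,1) bounded_clinearD(1)[OF T]]) simp
qed

text \<open>A phase c absorbed into x reduces this to the real inequality; the form of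
  \<open>op_abs T\<close> is the same at c x and x.\<close>

lemma mixed_Schwarz:
  assumes T: "bounded_clinear T"
  shows "(cmod (cinner (T x) y))\<^sup>2 \<le> (op_abs T x \<bullet> x) * (op_abs (cadjoint T) y \<bullet> y)"
proof -
  obtain c where c: "cmod c = 1" "cinner (c *\<^sub>C T x) y = cmod (cinner (T x) y)"
    by (rule cinner_phase)
  have adj: "T x \<bullet> y = x \<bullet> cadjoint T y" for x y
    by (simp add: cinner_cadjoint[OF T] flip: Re_cinner)
  have "cmod (cinner (T x) y) = T (c *\<^sub>C x) \<bullet> y"
    by (simp add: c bounded_clinearD[OF T] flip: Re_cinner)
  then have "(cmod (cinner (T x) y))\<^sup>2
      \<le> (op_abs T (c *\<^sub>C x) \<bullet> (c *\<^sub>C x)) * (op_abs (cadjoint T) y \<bullet> y)"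
    using mixed_Schwarz_real[OF bounded_clinearD(1)[OF T] adj psd_op_abs[OF T] op_abs_op_abs[OF T]
        psd_op_abs[OF bounded_clinear_cadjoint[OF T]] op_abs_intertwine[OF T], of "c *\<^sub>C x" y]
    by simp
  moreover have "cinner (op_abs T (c *\<^sub>C x)) (c *\<^sub>C x) = cinner (op_abs T x) x"
    using c(1) complex_norm_square[of c]
    by (simp add: op_abs_scaleC[OF T] cinner_scaleC_left cinner_scaleC_right mult.assoc[symmetric]
        mult.commute[of "cnj c"])
  then have "op_abs T (c *\<^sub>C x) \<bullet> (c *\<^sub>C x) = op_abs T x \<bullet> x"
    by (simp flip: Re_cinner)
  ultimately show ?thesis by simp
qed

section \<open>Buzano's inequality and the numerical radius\<close>

lemma Buzano:
  "2 * cmod (cinner u y) * cmod (cinner y v)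
    \<le> (norm u * norm v + cmod (cinner u v)) * (norm y)\<^sup>2"
proof -
  \<comment> \<open>For a unit vector \<open>y\<close>, \<open>w\<close> is the reflection of \<open>u\<close> in the line through \<open>y\<close>.\<close>
  define w where "w = (2 * cinner u y) *\<^sub>C y - (norm y)\<^sup>2 *\<^sub>R u"
  have w: "cinner w z = 2 * cinner u y * cinner y z - (norm y)\<^sup>2 * cinner u z" for z
    by (simp add: w_def cinner_diff_left cinner_scaleC_left cinner_scaleR_left)
  have "cinner w w = cnj (2 * cinner u y) * cinner w y - (norm y)\<^sup>2 * cinner w u"
    by (subst (2) w_def) (simp only: cinner_diff_right cinner_scaleC_right cinner_scaleR_right)
  also have "\<dots> = (norm y)\<^sup>2 * (norm y)\<^sup>2 * cinner u u"
    unfolding w cinner_self[of y] cinner_commute[of y u] by (simp add: algebra_simps)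
  also have "\<dots> = complex_of_real (((norm y)\<^sup>2 * norm u)\<^sup>2)"
    by (simp add: cinner_self power2_eq_square)
  finally have "cinner w w = complex_of_real (((norm y)\<^sup>2 * norm u)\<^sup>2)" .
  then have "norm w = (norm y)\<^sup>2 * norm u"
    unfolding cinner_self of_real_eq_iff by simp
  \<comment> \<open>Cauchy-Schwarz is applied only to <w, v>; the term with <u, v> is kept.\<close>
  moreover have "2 * cinner u y * cinner y v = cinner w v + (norm y)\<^sup>2 * cinner u v"
    by (simp add: w)
  then have "2 * cmod (cinner u y) * cmod (cinner y v)
      = cmod (cinner w v + (norm y)\<^sup>2 * cinner u v)"
    by (metis norm_mult norm_numeral)
  moreover have "cmod (cinner w v + (norm y)\<^sup>2 * cinner u v)
      \<le> norm w * norm v + (norm y)\<^sup>2 * cmod (cinner u v)"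
    using norm_triangle_ineq[of "cinner w v" "(norm y)\<^sup>2 * cinner u v"]
      complex_Cauchy_Schwarz[of w v]
    by (simp add: norm_mult norm_power)
  ultimately show ?thesis by (simp add: algebra_simps)
qed

lemma cmod_cinner_le_numerical_radius:
  assumes T: "bounded_linear T"
  shows "cmod (cinner (T x) x) \<le> numerical_radius T * (norm x)\<^sup>2"
proof (cases "x = 0")
  \<comment> \<open>On the zero space the radius is unspecified, but here it is multiplied by
    0.\<close>
  case True
  then show ?thesis using complex_Cauchy_Schwarz[of "T x" x] by simp
next
  case False
  interpret bounded_linear T by (rule T)
  define u where "u = x /\<^sub>R norm x"
  have u: "norm u = 1" "x = norm x *\<^sub>R u" using False by (auto simp: u_def)
  have "cmod (cinner (T z) z) \<le> onorm T" if "norm z = 1" for z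
    using complex_Cauchy_Schwarz[of "T z" z] onorm[OF T, of z] that by simp
  then have "cmod (cinner (T u) u) \<le> numerical_radius T"
    unfolding numerical_radius_def
    by (intro cSUP_upper bdd_aboveI2[of _ _ "onorm T"]) (auto simp: u)
  moreover have "cmod (cinner (T x) x) = (norm x)\<^sup>2 * cmod (cinner (T u) u)"
    by (subst (1 2) u(2))
      (simp add: scaleR cinner_scaleR_left cinner_scaleR_right norm_mult power2_eq_square)
  ultimately show ?thesis by (simp add: mult.commute mult_right_mono)
qed

lemma sqrt_sum_squares_le_numerical_radius:
  assumes S: "psd S" "\<And>c x. S (c *\<^sub>C x) = c *\<^sub>C S x"
    and T: "psd T" "\<And>c x. T (c *\<^sub>C x) = c *\<^sub>C T x"
  shows "sqrt ((S x \<bullet> x)\<^sup>2 + (T x \<bullet> x)\<^sup>2)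
    \<le> numerical_radius (\<lambda>z. S z + \<i> *\<^sub>C T z) * (norm x)\<^sup>2"
proof -
  have "bounded_linear (\<lambda>z. S z + \<i> *\<^sub>C T z)"
    by (intro bounded_linear_add psdD(1)[OF S(1)]
        bounded_linear_compose[OF bounded_linear_scaleC psdD(1)[OF T(1)]])
  then have "cmod (cinner (S x + \<i> *\<^sub>C T x) x)
      \<le> numerical_radius (\<lambda>z. S z + \<i> *\<^sub>C T z) * (norm x)\<^sup>2"
    by (rule cmod_cinner_le_numerical_radius)
  moreover have "cmod (cinner (S x + \<i> *\<^sub>C T x) x) = sqrt ((S x \<bullet> x)\<^sup>2 + (T x \<bullet> x)\<^sup>2)"
    by (simp add: cinner_add_left cinner_scaleC_left cinner_self_psd S T cmod_def)
  ultimately show ?thesis by simp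
qed

theorem lemma2p1:
  fixes A :: "'a::complex_hilbert_space \<Rightarrow> 'b::complex_hilbert_space"
    and B :: "'b \<Rightarrow> 'a"
    and x :: 'a and y :: 'b
  assumes "bounded_clinear A"
    and "bounded_clinear B"
  shows "cmod (cinner (A x) y) + cmod (cinner (B y) x)
    \<le> sqrt (numerical_radius (\<lambda>z. op_abs A z + \<i> *\<^sub>C op_abs (cadjoint B) z)
            * numerical_radius (\<lambda>z. op_abs (cadjoint A) z + \<i> *\<^sub>C op_abs B z)
          + onorm A * onorm B
          + numerical_radius (B \<circ> A))
      * norm x * norm y"
proof -
  note A = assms(1) and B = assms(2)
  note A' = bounded_clinear_cadjoint[OF A] and B' = bounded_clinear_cadjoint[OF B]
  let ?a = "cmod (cinner (A x) y)" and ?b = "cmod (cinner (B y) x)"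
  let ?V = "numerical_radius (\<lambda>z. op_abs A z + \<i> *\<^sub>C op_abs (cadjoint B) z)"
  let ?W = "numerical_radius (\<lambda>z. op_abs (cadjoint A) z + \<i> *\<^sub>C op_abs B z)"
  let ?p = "op_abs A x \<bullet> x" and ?q = "op_abs (cadjoint A) y \<bullet> y"
  let ?r = "op_abs (cadjoint B) x \<bullet> x" and ?t = "op_abs B y \<bullet> y"
  have "?a\<^sup>2 + ?b\<^sup>2 \<le> ?p * ?q + ?r * ?t"
    using mixed_Schwarz[OF A, of x y] mixed_Schwarz[OF B, of y x] by (simp add: mult.commute)
  also have "\<dots> \<le> sqrt (?p\<^sup>2 + ?r\<^sup>2) * sqrt (?q\<^sup>2 + ?t\<^sup>2)"
    using norm_cauchy_schwarz[of "(?p, ?r)" "(?q, ?t)"] by (simp add: norm_Pair)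
  also have "\<dots> \<le> (?V * (norm x)\<^sup>2) * (?W * (norm y)\<^sup>2)"
    by (intro mult_mono' sqrt_sum_squares_le_numerical_radius psd_op_abs op_abs_scaleC A A' B B')
      auto
  finally have squares: "?a\<^sup>2 + ?b\<^sup>2 \<le> ?V * ?W * ((norm x)\<^sup>2 * (norm y)\<^sup>2)"
    by (simp add: mult_ac)
  \<comment> \<open>Moving B across puts y in the middle, as Buzano's inequality requires for u = A
    x and v = \<open>cadjoint B x\<close>.\<close>
  have b: "?b = cmod (cinner y (cadjoint B x))" by (simp add: cinner_cadjoint[OF B])
  have BA: "cinner (A x) (cadjoint B x) = cinner ((B \<circ> A) x) x"
    by (simp add: cinner_cadjoint[OF B])
  have "2 * ?a * ?b
      \<le> (norm (A x) * norm (cadjoint B x) + cmod (cinner ((B \<circ> A) x) x)) * (norm y)\<^sup>2"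
    using Buzano[of "A x" y "cadjoint B x"] unfolding b BA .
  also have "\<dots> \<le> ((onorm A * norm x) * (onorm B * norm x)
      + numerical_radius (B \<circ> A) * (norm x)\<^sup>2) * (norm y)\<^sup>2"
    by (intro mult_right_mono add_mono mult_mono' norm_cadjoint_le onorm
        cmod_cinner_le_numerical_radius bounded_clinearD(1) bounded_clinear_compose A B) auto
  finally have "2 * ?a * ?b
      \<le> (onorm A * onorm B + numerical_radius (B \<circ> A)) * ((norm x)\<^sup>2 * (norm y)\<^sup>2)"
    by (simp add: power2_eq_square algebra_simps)
  then have "(?a + ?b)\<^sup>2 \<le> (?V * ?W + onorm A * onorm B + numerical_radius (B \<circ> A))
      * ((norm x)\<^sup>2 * (norm y)\<^sup>2)"
    using squares by (simp add: power2_sum algebra_simps)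
  \<comment> \<open>The sign of the radicand is not examined: \<open>sqrt\<close> is monotone and
    multiplicative on all reals, and a radius on the zero space is unspecified.\<close>
  then have "sqrt ((?a + ?b)\<^sup>2) \<le> sqrt ((?V * ?W + onorm A * onorm B + numerical_radius (B \<circ> A))
      * ((norm x)\<^sup>2 * (norm y)\<^sup>2))"
    by (rule real_sqrt_le_mono)
  then show ?thesis by (simp add: real_sqrt_mult mult.assoc)
qed

end
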